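(* Let $\varepsilon>0$, let $n$ be an integer and let $b\leq(1-\varepsilon)n$. Then in the $(1:b)$ random-Breaker perfect-matching game played on $E(K_n)$, Maker has a strategy which is w.h.p.\ a winning strategy, and with it he wins within $(1+o(1))\frac n2$ rounds.
   Context: The $(1:b)$ random-Breaker game on the board $E(K_n)$: Maker and Breaker alternately claim previously unclaimed edges of $K_n$, Breaker moving first. In each round Breaker claims $b$ edges chosen uniformly at random among all unclaimed edges, and then Maker claims one unclaimed edge of his choice. In the perfect-matching game, Maker wins if his graph contains $\lfloor n/2\rfloor$ pairwise disjoint edges (a perfect matching, or a matching covering all but one vertex if $n$ is odd). "W.h.p." means with probability tending to $1$ as $n\to\infty$. *)

theory Defs
  imports "HOL-Probability.Probability"
begin

type_synonym edge = "nat set"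

definition complete_graph_edges :: "nat \<Rightarrow> edge set" where
  "complete_graph_edges n = {e. e \<subseteq> {..<n} \<and> card e = 2}"

text \<open>
  A round consists of the set of edges claimed by Breaker and the set of edges claimed by
  Maker; the latter is a singleton, or empty if Breaker left no unclaimed edge.
  A history lists the completed rounds in chronological order.
\<close>

type_synonym history = "(edge set \<times> edge set) list"

definition maker_graph :: "history \<Rightarrow> edge set" where
  "maker_graph h = (\<Union>r\<in>set h. snd r)"

definition breaker_graph :: "history \<Rightarrow> edge set" where
  "breaker_graph h = (\<Union>r\<in>set h. fst r)"

definition unclaimed :: "nat \<Rightarrow> history \<Rightarrow> edge set" where
  "unclaimed n h = complete_graph_edges n - (maker_graph h \<union> breaker_graph h)"

text \<open>
  A strategy of Maker maps the completed rounds and Breaker's move in the current round to an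
  edge.
\<close>

type_synonym strategy = "history \<Rightarrow> edge set \<Rightarrow> edge"

definition legal_strategy :: "nat \<Rightarrow> strategy \<Rightarrow> bool" where
  "legal_strategy n \<sigma> \<longleftrightarrow>
     (\<forall>h B. B \<subseteq> unclaimed n h \<longrightarrow> unclaimed n h - B \<noteq> {} \<longrightarrow> \<sigma> h B \<in> unclaimed n h - B)"

text \<open>
  If fewer than \<open>b\<close> edges are unclaimed, Breaker takes all of them.
\<close>

definition random_breaker_move :: "nat \<Rightarrow> edge set \<Rightarrow> edge set pmf" where
  "random_breaker_move b F = pmf_of_set {B. B \<subseteq> F \<and> card B = min b (card F)}"

definition maker_move :: "nat \<Rightarrow> strategy \<Rightarrow> history \<Rightarrow> edge set \<Rightarrow> edge set" where
  "maker_move n \<sigma> h B = (if unclaimed n h - B = {} then {} else {\<sigma> h B})"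

primrec random_breaker_play :: "nat \<Rightarrow> nat \<Rightarrow> strategy \<Rightarrow> nat \<Rightarrow> history pmf" where
  "random_breaker_play n b \<sigma> 0 = return_pmf []"
| "random_breaker_play n b \<sigma> (Suc k) =
     bind_pmf (random_breaker_play n b \<sigma> k) (\<lambda>h.
       map_pmf (\<lambda>B. h @ [(B, maker_move n \<sigma> h B)]) (random_breaker_move b (unclaimed n h)))"

text \<open>
  Every round claims at least one edge as long as one is unclaimed, so after as many rounds as
  there are edges the board is exhausted; possible surplus rounds at the end are empty.
\<close>

definition random_breaker_game :: "nat \<Rightarrow> nat \<Rightarrow> strategy \<Rightarrow> history pmf" where
  "random_breaker_game n b \<sigma> = random_breaker_play n b \<sigma> (card (complete_graph_edges n))"

definition perfect_matching_win :: "nat \<Rightarrow> history \<Rightarrow> bool" where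
  "perfect_matching_win n h \<longleftrightarrow>
     (\<exists>M. M \<subseteq> maker_graph h \<and> card M = n div 2 \<and> pairwise disjnt M)"

definition perfect_matching_win_within :: "nat \<Rightarrow> real \<Rightarrow> history \<Rightarrow> bool" where
  "perfect_matching_win_within n t h \<longleftrightarrow>
     (\<exists>k. real k \<le> t \<and> perfect_matching_win n (take k h))"

end

theory Submission
  imports Defs "HOL-Real_Asymp.Real_Asymp"
begin

text \<open>
  Put \<open>s \<approx> n\<^bsup>1/4\<^esup>\<close> and \<open>T = n div 2 + 2 s\<^sup>2\<close>. During \<open>T\<close> rounds the random Breaker claims all of
  a fixed edge set \<open>S\<close> with probability at most \<open>q ^ card S\<close>, where \<open>q = T (b + 1) / card E(K\<^sub>n)\<close> is
  eventually at most \<open>1 - \<epsilon> / 2\<close>. By a union bound, w.h.p. Breaker leaves an edge between any two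
  disjoint \<open>s\<close>-sets of vertices, and an edge from every vertex to every set of \<open>n - 1 - 5 s\<close> others.

  Against any Breaker restricted in this way, Maker wins in \<open>T\<close> rounds. He extends a matching greedily
  until about \<open>2 s\<close> vertices are uncovered. Then he takes two uncovered vertices \<open>u\<close>, \<open>v\<close>, claims \<open>s\<close>
  edges \<open>u x\<close> and \<open>s\<close> edges \<open>v y\<close> to covered vertices, and finds a free edge between a partner of
  some \<open>x\<close> and a partner of some \<open>y\<close>; this closes an augmenting path with five edges. Each augmentation
  costs \<open>2 s + 1\<close> rounds, and \<open>s\<close> of them suffice.
\<close>

section \<open>The deterministic game\<close>

definition spares :: "edge set set \<Rightarrow> edge set \<Rightarrow> bool" where
  "spares \<F> Br \<longleftrightarrow> (\<forall>S\<in>\<F>. \<not> S \<subseteq> Br)"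

text \<open>
  Breaker's whole graph may be replaced by an arbitrary one in every round, as long as it contains no
  member of \<open>\<F>\<close>; hence the state of this game is Maker's graph alone.
\<close>

primrec can_force :: "edge set \<Rightarrow> edge set set \<Rightarrow> (edge set \<Rightarrow> bool) \<Rightarrow> nat \<Rightarrow> edge set \<Rightarrow> bool" where
  "can_force E \<F> Q 0 M \<longleftrightarrow> Q M"
| "can_force E \<F> Q (Suc c) M \<longleftrightarrow>
     Q M \<or> (\<forall>Br. spares \<F> Br \<longrightarrow> (\<exists>e\<in>E - M - Br. can_force E \<F> Q c (insert e M)))"

lemma can_force_goal: "Q M \<Longrightarrow> can_force E \<F> Q c M"
  by (cases c) auto

lemma can_force_Suc: "can_force E \<F> Q c M \<Longrightarrow> can_force E \<F> Q (Suc c) M"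
proof (induction c arbitrary: M)
  case (Suc c)
  then show ?case
    unfolding can_force.simps(2)[of E \<F> Q "Suc c"] can_force.simps(2)[of E \<F> Q c M] by blast
qed simp

lemma can_force_mono: "can_force E \<F> Q c M \<Longrightarrow> c \<le> d \<Longrightarrow> can_force E \<F> Q d M"
  by (induction d rule: nat_induct) (auto simp: le_Suc_eq simp del: can_force.simps intro: can_force_Suc)

text \<open>Consecutive phases of Maker's play add up their round budgets; if the first goal is
  reached early, monotonicity in the number of rounds absorbs the surplus.\<close>

lemma can_force_trans:
  assumes "can_force E \<F> Q c M" "\<And>M'. Q M' \<Longrightarrow> can_force E \<F> R d M'"
  shows "can_force E \<F> R (c + d) M"
  using assms(1)
proof (induction c arbitrary: M)
  case (Suc c)
  show ?case
  proof (cases "Q M")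
    case True
    then show ?thesis using assms(2) can_force_mono by (metis le_add2)
  next
    case False
    then show ?thesis using Suc by (auto; blast)
  qed
qed (simp add: assms(2))

lemma can_force_chain:
  assumes "\<And>i M. i < k \<Longrightarrow> P i M \<Longrightarrow> can_force E \<F> (P (Suc i)) c M" "P 0 M"
  shows "can_force E \<F> (P k) (k * c) M"
  using assms
proof (induction k)
  case 0
  then show ?case by simp
next
  case (Suc k)
  have "can_force E \<F> (P k) (k * c) M" using Suc by simp
  from can_force_trans[OF this Suc.prems(1)] show ?case by (simp add: add.commute)
qed

section \<open>Obstacles and the augmentation of matchings\<close>

definition cross :: "nat set \<Rightarrow> nat set \<Rightarrow> edge set" where
  "cross A B = (\<lambda>(a, b). {a, b}) ` (A \<times> B)"

text \<open>The copies of \<open>K(s, s)\<close> yield free edges for greedy steps and for closing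
  augmenting paths, the stars yield edges at an uncovered vertex. During an augmentation at most
  \<open>2 * s + 1\<close> vertices are uncovered, at most \<open>2 * s\<close> are barred by the
  first star and fewer than \<open>s\<close> are already joined, so at least
  \<open>n - 5 * s\<close> candidates remain, enough for a star.\<close>

definition obstacles :: "nat \<Rightarrow> nat \<Rightarrow> edge set set" where
  "obstacles n s =
     {cross A B |A B. A \<subseteq> {..<n} \<and> B \<subseteq> {..<n} \<and> A \<inter> B = {} \<and> card A = s \<and> card B = s} \<union>
     {cross {v} W |v W. v < n \<and> W \<subseteq> {..<n} - {v} \<and> card W = n - 1 - 5 * s}"

text \<open>
  A matching is represented by the set \<open>D\<close> of covered vertices and the fixed-point-free involution
  \<open>p\<close> that sends a covered vertex to its partner.
\<close>

definition pairing :: "nat \<Rightarrow> nat set \<Rightarrow> (nat \<Rightarrow> nat) \<Rightarrow> edge set \<Rightarrow> bool" where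
  "pairing n D p M \<longleftrightarrow>
     D \<subseteq> {..<n} \<and> (\<forall>x\<in>D. p x \<in> D \<and> p x \<noteq> x \<and> p (p x) = x \<and> {x, p x} \<in> M)"

definition has_pairing :: "nat \<Rightarrow> nat \<Rightarrow> edge set \<Rightarrow> bool" where
  "has_pairing n k M \<longleftrightarrow> (\<exists>D p. pairing n D p M \<and> card D = 2 * k)"

lemma pairing_mono: "pairing n D p M \<Longrightarrow> M \<subseteq> M' \<Longrightarrow> pairing n D p M'"
  unfolding pairing_def by blast

lemma has_pairing_mono: "has_pairing n k M \<Longrightarrow> M \<subseteq> M' \<Longrightarrow> has_pairing n k M'"
  unfolding has_pairing_def using pairing_mono by blast

lemma has_pairing_matching:
  assumes "has_pairing n k M"
  shows "\<exists>M'. M' \<subseteq> M \<and> card M' = k \<and> pairwise disjnt M'"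
proof -
  obtain D p where Dp: "pairing n D p M" "card D = 2 * k"
    using assms has_pairing_def by auto
  define M' where "M' = (\<lambda>x. {x, p x}) ` D"
  have D: "x \<in> D \<Longrightarrow> p x \<in> D \<and> p x \<noteq> x \<and> p (p x) = x \<and> {x, p x} \<in> M" for x
    using Dp unfolding pairing_def by blast
  have "pairwise disjnt M'"
    unfolding pairwise_def M'_def disjnt_def using D
    by (smt (verit, best) disjoint_iff doubleton_eq_iff imageE insertE singletonD)
  moreover have "M' \<subseteq> M" using D unfolding M'_def by blast
  moreover have "card M' = k"
  proof -
    \<comment> \<open>Both \<open>x\<close> and \<open>p x\<close> yield the same edge, so endpoints
      are counted instead: the edges are disjoint, have two elements each, and cover exactly
      \<open>D\<close>.\<close>
    have "card (\<Union>M') = sum card M'"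
      by (rule card_Union_disjoint) (use \<open>pairwise disjnt M'\<close> in \<open>auto simp: M'_def\<close>)
    also have "\<dots> = (\<Sum>e\<in>M'. 2)"
    proof (rule sum.cong)
      fix e assume "e \<in> M'"
      then obtain x where "x \<in> D" "e = {x, p x}" unfolding M'_def by blast
      then show "card e = 2" using D[of x] by auto
    qed simp
    also have "\<Union>M' = D" using D unfolding M'_def by auto
    finally show ?thesis using Dp(2) by simp
  qed
  ultimately show ?thesis by blast
qed

lemma spares_obstacles_cross:
  assumes "spares (obstacles n s) Br" "A \<subseteq> {..<n}" "B \<subseteq> {..<n}" "A \<inter> B = {}" "s \<le> card A" "s \<le> card B"
  shows "\<exists>a\<in>A. \<exists>b\<in>B. {a, b} \<notin> Br"
proof -
  obtain A' B' where AB: "A' \<subseteq> A" "card A' = s" "B' \<subseteq> B" "card B' = s"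
    using assms by (meson obtain_subset_with_card_n)
  then have "cross A' B' \<in> obstacles n s" using assms unfolding obstacles_def by blast
  then have "\<not> cross A' B' \<subseteq> Br" using assms(1) spares_def by blast
  then show ?thesis using AB unfolding cross_def by auto
qed

lemma spares_obstacles_star:
  assumes "spares (obstacles n s) Br" "v < n" "W \<subseteq> {..<n} - {v}" "n - 1 - 5 * s \<le> card W"
  shows "\<exists>w\<in>W. {v, w} \<notin> Br"
proof -
  obtain W' where W: "W' \<subseteq> W" "card W' = n - 1 - 5 * s"
    using assms by (meson obtain_subset_with_card_n)
  then have "cross {v} W' \<in> obstacles n s" using assms unfolding obstacles_def by blast
  then have "\<not> cross {v} W' \<subseteq> Br" using assms(1) spares_def by blast
  then show ?thesis using W unfolding cross_def by auto
qed

lemma doubleton_in_complete_graph: "a < n \<Longrightarrow> b < n \<Longrightarrow> a \<noteq> b \<Longrightarrow> {a, b} \<in> complete_graph_edges n"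
  unfolding complete_graph_edges_def by (auto simp: card_2_iff)

lemma pairing_add_edge:
  assumes "pairing n D p M" "card D = 2 * k" "a < n" "b < n" "a \<noteq> b" "a \<notin> D" "b \<notin> D" "{a, b} \<in> M"
  shows "has_pairing n (Suc k) M"
proof -
  have D: "x \<in> D \<Longrightarrow> p x \<in> D \<and> p x \<noteq> x \<and> p (p x) = x \<and> {x, p x} \<in> M" for x
    using assms unfolding pairing_def by blast
  have fin: "finite D" using assms(1) finite_subset unfolding pairing_def by blast
  have ba: "{b, a} \<in> M" using assms(8) by (simp add: insert_commute)
  have "pairing n (insert a (insert b D)) (p(a := b, b := a)) M"
    unfolding pairing_def using assms D ba pairing_def by auto
  moreover have "card (insert a (insert b D)) = 2 * Suc k"
    using assms fin by simp
  ultimately show ?thesis unfolding has_pairing_def by blast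
qed

text \<open>The path \<open>u, x, p x, p y, y, v\<close> is augmenting: its two matching edges are
  exchanged for the other three. The conditions on \<open>y\<close> make these two matching edges
  distinct.\<close>

lemma pairing_augment:
  assumes "pairing n D p M" "card D = 2 * k" "u < n" "v < n" "u \<noteq> v" "u \<notin> D" "v \<notin> D"
    and "x \<in> D" "y \<in> D" "y \<noteq> x" "y \<noteq> p x"
    and "{u, x} \<in> M" "{p x, p y} \<in> M" "{v, y} \<in> M"
  shows "has_pairing n (Suc k) M"
proof -
  have D: "z \<in> D \<Longrightarrow> p z \<in> D \<and> p z \<noteq> z \<and> p (p z) = z \<and> {z, p z} \<in> M" for z
    using assms unfolding pairing_def by blast
  have fin: "finite D" using assms(1) finite_subset unfolding pairing_def by blast
  have sym: "{x, u} \<in> M" "{p y, p x} \<in> M" "{y, v} \<in> M"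
    using assms by (simp_all add: insert_commute)
  have D1: "p x \<in> D" "p y \<in> D" "p x \<noteq> x" "p y \<noteq> y" "p x \<noteq> p y" "p y \<noteq> x"
    using D assms by metis+
  \<comment> \<open>An involution that preserves the four inner path vertices maps the rest of
    \<open>D\<close> off the path, so the new pairing agrees with \<open>p\<close> at both
    \<open>z\<close> and \<open>p z\<close>.\<close>
  have other: "p z \<noteq> u \<and> p z \<noteq> v \<and> p z \<noteq> x \<and> p z \<noteq> y \<and> p z \<noteq> p x \<and> p z \<noteq> p y"
    if "z \<in> D" "z \<noteq> x" "z \<noteq> y" "z \<noteq> p x" "z \<noteq> p y" for z
    using D assms that by metis
  define q where "q = p(u := x, x := u, v := y, y := v, p x := p y, p y := p x)"
  have "u \<noteq> x" "u \<noteq> y" "u \<noteq> p x" "u \<noteq> p y" "v \<noteq> x" "v \<noteq> y" "v \<noteq> p x" "v \<noteq> p y"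
    using assms(6-9) D1(1,2) by metis+
  \<comment> \<open>All inequalities among the six path vertices, in both orientations, so that the
    nested updates in \<open>q\<close> can be evaluated.\<close>
  note distinct = this this[symmetric] assms(5,10,11) D1(3-6) assms(5,10,11)[symmetric] D1(3-6)[symmetric]
  have q: "q u = x" "q x = u" "q v = y" "q y = v" "q (p x) = p y" "q (p y) = p x"
    unfolding q_def by (simp_all add: distinct)
  have q_other: "q z = p z" if "z \<noteq> u" "z \<noteq> v" "z \<noteq> x" "z \<noteq> y" "z \<noteq> p x" "z \<noteq> p y" for z
    unfolding q_def using that by simp
  have "q z \<in> insert u (insert v D) \<and> q z \<noteq> z \<and> q (q z) = z \<and> {z, q z} \<in> M"
    if z: "z \<in> insert u (insert v D)" for z
  proof -
    consider "z = u" | "z = v" | "z = x" | "z = y" | "z = p x" | "z = p y"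
      | "z \<in> D" "z \<noteq> u" "z \<noteq> v" "z \<noteq> x" "z \<noteq> y" "z \<noteq> p x" "z \<noteq> p y"
      using z assms by auto
    then show ?thesis
    proof cases
      case 7
      then show ?thesis using D[of z] other[of z] q_other[of z] q_other[of "p z"] by simp
    qed (simp_all add: q distinct assms(8,9,12-14) D1 sym)
  qed
  then have "pairing n (insert u (insert v D)) q M"
    using assms unfolding pairing_def by blast
  moreover have "card (insert u (insert v D)) = 2 * Suc k"
    using assms fin by simp
  ultimately show ?thesis unfolding has_pairing_def by blast
qed

section \<open>Forcing a perfect matching against a restricted Breaker\<close>

lemma can_force_one:
  assumes "\<not> Q M \<Longrightarrow> (\<And>Br. spares \<F> Br \<Longrightarrow> \<exists>e\<in>E - M - Br. Q (insert e M))"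
  shows "can_force E \<F> Q 1 M"
  using assms by auto

text \<open>While at least \<open>2 * s\<close> vertices are uncovered, they contain two disjoint
  \<open>s\<close>-sets, and Breaker does not own all edges between them.\<close>

lemma can_force_greedy_step:
  assumes "has_pairing n k M" "2 * k + 2 * s \<le> n"
  shows "can_force (complete_graph_edges n) (obstacles n s) (has_pairing n (Suc k)) 1 M"
proof (rule can_force_one)
  fix Br assume no: "\<not> has_pairing n (Suc k) M" and Br: "spares (obstacles n s) Br"
  obtain D p where D: "pairing n D p M" "card D = 2 * k"
    using assms(1) has_pairing_def by auto
  have Dn: "D \<subseteq> {..<n}" using D pairing_def by auto
  then have "card ({..<n} - D) = n - 2 * k"
    using D by (simp add: card_Diff_subset finite_subset)
  then obtain A where A: "A \<subseteq> {..<n} - D" "card A = s"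
    using assms by (metis add_leD2 add_le_imp_le_diff add.commute mult_2 obtain_subset_with_card_n trans_le_add1)
  have "finite A" using A finite_subset by auto
  then have "card ({..<n} - D - A) = n - 2 * k - s"
    using A \<open>card ({..<n} - D) = n - 2 * k\<close> by (simp add: card_Diff_subset)
  then have "\<exists>a\<in>A. \<exists>b\<in>{..<n} - D - A. {a, b} \<notin> Br"
    by (intro spares_obstacles_cross[OF Br]) (use A assms in auto)
  then obtain a b where ab: "a \<in> A" "b \<in> {..<n} - D - A" "{a, b} \<notin> Br"
    by blast
  \<comment> \<open>If Maker already owned this edge, \<open>M\<close> would contain the larger
    pairing. The negated goal in \<open>can_force_one\<close> serves this purpose in every
    phase.\<close>
  then have "{a, b} \<notin> M" using no pairing_add_edge[OF D, of a b] A by auto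
  moreover have "has_pairing n (Suc k) (insert {a, b} M)"
    by (rule pairing_add_edge[OF pairing_mono[OF D(1)] D(2), of _ a b]) (use ab A in auto)
  moreover have "{a, b} \<in> complete_graph_edges n"
    by (rule doubleton_in_complete_graph) (use ab A in auto)
  ultimately show "\<exists>e\<in>complete_graph_edges n - M - Br. has_pairing n (Suc k) (insert e M)"
    using ab by auto
qed

text \<open>\<open>M0\<close> carries along the edges claimed before the star was begun, so that the
  matching and the first star survive the later phases.\<close>

definition has_star :: "nat \<Rightarrow> nat set \<Rightarrow> edge set \<Rightarrow> nat \<Rightarrow> edge set \<Rightarrow> bool" where
  "has_star v C M0 i M \<longleftrightarrow> M0 \<subseteq> M \<and> (\<exists>X. X \<subseteq> C \<and> card X = i \<and> (\<forall>x\<in>X. {v, x} \<in> M))"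

text \<open>Before each round fewer than \<open>k\<close> vertices of \<open>C\<close> are joined to
  \<open>v\<close>, so at least \<open>n - 1 - 5 * s\<close> others remain, and Breaker does not own
  all edges from \<open>v\<close> to them. The strict inequality accounts for the
  \<open>+ 1\<close>.\<close>

lemma can_force_star:
  assumes "v < n" "C \<subseteq> {..<n} - {v}" "n - 1 - 5 * s + k \<le> card C + 1" "M0 \<subseteq> M"
  shows "can_force (complete_graph_edges n) (obstacles n s) (has_star v C M0 k) k M"
proof -
  let ?P = "has_star v C M0"
  have finC: "finite C" by (rule finite_subset[OF assms(2)]) simp
  have "can_force (complete_graph_edges n) (obstacles n s) (?P k) (k * 1) M"
  proof (rule can_force_chain)
    fix i M assume i: "i < k" and "?P i M"
    then obtain X where X: "M0 \<subseteq> M" "X \<subseteq> C" "card X = i" "\<forall>x\<in>X. {v, x} \<in> M"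
      unfolding has_star_def by blast
    have finX: "finite X" using X finC finite_subset by auto
    have add: "?P (Suc i) M'" if "w \<in> C - X" "M \<subseteq> M'" "{v, w} \<in> M'" for w M'
      unfolding has_star_def
      by (rule conjI[OF _ exI[of _ "insert w X"]]) (use X finX that in auto)
    show "can_force (complete_graph_edges n) (obstacles n s) (?P (Suc i)) 1 M"
    proof (rule can_force_one)
      fix Br assume no: "\<not> ?P (Suc i) M" and Br: "spares (obstacles n s) Br"
      have "card (C - X) = card C - i" using X finX by (simp add: card_Diff_subset)
      then obtain w where w: "w \<in> C - X" "{v, w} \<notin> Br"
        using spares_obstacles_star[OF Br assms(1), of "C - X"] assms i by fastforce
      have "{v, w} \<in> complete_graph_edges n"
        by (rule doubleton_in_complete_graph) (use w assms in auto)
      then show "\<exists>e\<in>complete_graph_edges n - M - Br. ?P (Suc i) (insert e M)"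
        using add[OF w(1)] no w by (intro bexI[of _ "{v, w}"]) auto
    qed
  next
    show "?P 0 M" using assms unfolding has_star_def by auto
  qed
  then show ?thesis by simp
qed

text \<open>The middle edge of the augmenting path is fixed only after both stars are built:
  \<open>s\<close> possible ends on each side leave Breaker no way to block all choices.\<close>

lemma can_force_augment_step:
  assumes "has_pairing n k M" "2 * k + 2 \<le> n" "n \<le> 2 * k + 2 * s + 1" "5 * s < n"
  shows "can_force (complete_graph_edges n) (obstacles n s) (has_pairing n (Suc k)) (2 * s + 1) M"
proof -
  let ?force = "can_force (complete_graph_edges n) (obstacles n s)"
  obtain D p where D: "pairing n D p M" "card D = 2 * k"
    using assms(1) has_pairing_def by auto
  have Dn: "D \<subseteq> {..<n}" using D pairing_def by auto
  have finD: "finite D" using Dn finite_subset by auto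
  have p: "p x \<in> D" "p (p x) = x" if "x \<in> D" for x
    using D that unfolding pairing_def by auto
  have "card ({..<n} - D) = n - 2 * k"
    using D Dn by (simp add: card_Diff_subset finD)
  then have "2 \<le> card ({..<n} - D)" using assms by auto
  then obtain P where "P \<subseteq> {..<n} - D" "card P = 2"
    by (meson obtain_subset_with_card_n)
  then obtain u v where uv: "u < n" "v < n" "u \<notin> D" "v \<notin> D" "u \<noteq> v"
    by (auto simp: card_2_iff)
  have star_u: "?force (has_star u D M s) s M"
    by (rule can_force_star) (use uv Dn D assms in auto)
  have rest: "?force (has_pairing n (Suc k)) (s + 1) M1" if star: "has_star u D M s M1" for M1
  proof -
    obtain X where X: "M \<subseteq> M1" "X \<subseteq> D" "card X = s" "\<forall>x\<in>X. {u, x} \<in> M1"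
      using star unfolding has_star_def by blast
    have finX: "finite X" using X finD finite_subset by auto
    \<comment> \<open>Removing \<open>X\<close> and its partners ensures that every choice of
      \<open>x\<close> and \<open>y\<close> uses two different matching edges and that the partner
      sets of the two stars are disjoint.\<close>
    define C where "C = D - (X \<union> p ` X)"
    have "card (X \<union> p ` X) \<le> 2 * s"
      using card_Un_le[of X "p ` X"] card_image_le[OF finX, of p] X by linarith
    then have "2 * k - 2 * s \<le> card C"
      unfolding C_def using diff_card_le_card_Diff[of "X \<union> p ` X" D] finX D by simp
    then have star_v: "?force (has_star v C M1 s) s M1"
      by (intro can_force_star) (use uv Dn D assms in \<open>auto simp: C_def\<close>)
    have last: "?force (has_pairing n (Suc k)) 1 M2" if star: "has_star v C M1 s M2" for M2
    proof (rule can_force_one)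
      obtain Y where Y: "M1 \<subseteq> M2" "Y \<subseteq> C" "card Y = s" "\<forall>y\<in>Y. {v, y} \<in> M2"
        using star unfolding has_star_def by blast
      fix Br assume no: "\<not> has_pairing n (Suc k) M2" and Br: "spares (obstacles n s) Br"
      have YD: "Y \<subseteq> D" using Y C_def by auto
      have inj: "inj_on p D" using p by (metis inj_onI)
      have disj: "p ` X \<inter> p ` Y = {}"
        using Y(2) X(2) inj unfolding C_def by (auto dest: inj_onD)
      obtain x y where xy: "x \<in> X" "y \<in> Y" "{p x, p y} \<notin> Br"
      proof -
        have "p ` X \<subseteq> {..<n}" "p ` Y \<subseteq> {..<n}" using p(1) X(2) YD Dn by blast+
        moreover have "card (p ` X) = s" "card (p ` Y) = s"
          using X Y YD inj by (metis card_image inj_on_subset)+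
        ultimately have "\<exists>a\<in>p ` X. \<exists>b\<in>p ` Y. {a, b} \<notin> Br"
          by (intro spares_obstacles_cross[OF Br _ _ disj]) simp_all
        then show ?thesis using that by blast
      qed
      have aug: "has_pairing n (Suc k) M3" if "M2 \<subseteq> M3" "{p x, p y} \<in> M3" for M3
        by (rule pairing_augment[OF pairing_mono[OF D(1)] D(2), where u = u and v = v and x = x and y = y])
          (use that X Y uv xy C_def in auto)
      have "{p x, p y} \<in> complete_graph_edges n"
      proof (rule doubleton_in_complete_graph)
        show "p x < n" "p y < n" using p(1) xy X(2) YD Dn by blast+
      qed (use xy disj in auto)
      then show "\<exists>e\<in>complete_graph_edges n - M2 - Br. has_pairing n (Suc k) (insert e M2)"
        using aug no xy by (intro bexI[of _ "{p x, p y}"]) auto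
    qed
    show ?thesis using can_force_trans[OF star_v last] by simp
  qed
  have "?force (has_pairing n (Suc k)) (s + (s + 1)) M"
    by (rule can_force_trans[OF star_u rest])
  then show ?thesis by (simp add: mult_2)
qed

text \<open>The greedy phase stops \<open>s\<close> edges short, and each missing edge costs
  \<open>2 * s + 1\<close> rounds. The hypothesis gives \<open>s \<le> n div 2\<close>, so the
  subtraction in \<open>k\<close> is exact.\<close>

lemma can_force_perfect_matching:
  assumes "5 * s < n"
  shows "can_force (complete_graph_edges n) (obstacles n s) (has_pairing n (n div 2)) (n div 2 + 2 * s ^ 2) {}"
proof -
  let ?force = "can_force (complete_graph_edges n) (obstacles n s)"
  define k where "k = n div 2 - s"
  have greedy: "?force (has_pairing n k) (k * 1) {}"
  proof (rule can_force_chain)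
    show "has_pairing n 0 {}" unfolding has_pairing_def pairing_def by auto
  qed (rule can_force_greedy_step, auto simp: k_def)
  have aug: "?force (has_pairing n (k + s)) (s * (2 * s + 1)) M" if "has_pairing n k M" for M
  proof (rule can_force_chain[where P = "\<lambda>i. has_pairing n (k + i)"])
    fix i M assume "i < s" "has_pairing n (k + i) M"
    then show "?force (has_pairing n (k + Suc i)) (2 * s + 1) M"
      using can_force_augment_step[of n "k + i" M s] assms unfolding k_def by simp
  qed (use that in simp)
  have "k + s = n div 2" using assms k_def by simp
  moreover from this have "k * 1 + s * (2 * s + 1) = n div 2 + 2 * s ^ 2"
    by (simp add: algebra_simps power2_eq_square)
  ultimately show ?thesis using can_force_trans[OF greedy aug] by simp
qed

section \<open>Random subsets of fixed size\<close>

text \<open>A uniform \<open>b\<close>-subset of an \<open>f\<close>-set contains a fixed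
  \<open>r\<close>-set with probability the product of the ratios \<open>(b - i) / (f - i)\<close>,
  each at most \<open>b / f\<close>. Denominators are cleared to stay within the naturals.\<close>

lemma binomial_ratio_le:
  "r \<le> b \<Longrightarrow> b \<le> f \<Longrightarrow> f ^ r * ((f - r) choose (b - r)) \<le> b ^ r * (f choose b)"
proof (induction r arbitrary: f b)
  case (Suc r)
  obtain f' b' where fb: "f = Suc f'" "b = Suc b'" using Suc.prems by (cases f; cases b) auto
  have IH: "f' ^ r * ((f' - r) choose (b' - r)) \<le> b' ^ r * (f' choose b')"
    using Suc fb by simp
  show ?case
  proof (cases "f' = 0")
    case True
    then show ?thesis using Suc.prems fb by simp
  next
    case False
    \<comment> \<open>The factor \<open>f' ^ r\<close> is cancelled at the end; it lets
      \<open>b' / f' \<le> Suc b' / Suc f'\<close> enter as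
      \<open>Suc f' * b' \<le> Suc b' * f'\<close>.\<close>
    have "f' ^ r * (Suc f' ^ Suc r * ((f' - r) choose (b' - r))) \<le> Suc f' ^ Suc r * (b' ^ r * (f' choose b'))"
      using mult_le_mono2[OF IH, of "Suc f' ^ Suc r"] by (simp add: mult_ac)
    also have "\<dots> = (Suc f' * b') ^ r * (Suc f' * (f' choose b'))"
      by (simp only: power_mult_distrib power_Suc mult_ac)
    also have "\<dots> \<le> (Suc b' * f') ^ r * (Suc f' * (f' choose b'))"
      using Suc.prems fb by (intro mult_le_mono1 power_mono) auto
    also have "Suc f' * (f' choose b') = Suc b' * (Suc f' choose Suc b')"
      by (simp only: Suc_times_binomial_eq mult.commute)
    finally have "f' ^ r * (Suc f' ^ Suc r * ((f' - r) choose (b' - r)))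
        \<le> f' ^ r * (Suc b' ^ Suc r * (Suc f' choose Suc b'))"
      by (simp only: power_mult_distrib power_Suc mult_ac)
    then show ?thesis using False fb by simp
  qed
qed simp

lemma card_supersets_le:
  assumes "finite F" "b \<le> card F" "R \<subseteq> F" "F \<noteq> {}"
  shows "real (card {B. B \<subseteq> F \<and> card B = b \<and> R \<subseteq> B}) \<le> (real b / card F) ^ card R * (card F choose b)"
proof (cases "card R \<le> b")
  case True
  have fin: "finite R" using assms finite_subset by auto
  have "bij_betw (\<lambda>B. B \<union> R) {B. B \<subseteq> F - R \<and> card B = b - card R} {B. B \<subseteq> F \<and> card B = b \<and> R \<subseteq> B}"
  proof (rule bij_betwI[where g = "\<lambda>B. B - R"], goal_cases)
    case 1
    have "card (B \<union> R) = b" if "B \<subseteq> F - R" "card B = b - card R" for B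
      using that True fin assms(1) card_Un_disjoint[of B R] finite_subset[of B "F - R"] by auto
    then show ?case using assms by auto
  next
    case 2
    then show ?case using fin by (auto simp: card_Diff_subset)
  qed auto
  then have "card {B. B \<subseteq> F \<and> card B = b \<and> R \<subseteq> B} = ((card F - card R) choose (b - card R))"
    using n_subsets[of "F - R" "b - card R"] assms fin
    by (simp add: card_Diff_subset bij_betw_same_card[symmetric])
  moreover have "real (card F ^ card R * ((card F - card R) choose (b - card R)))
      \<le> real (b ^ card R * (card F choose b))"
    using binomial_ratio_le[OF True assms(2)] by (rule of_nat_mono)
  ultimately show ?thesis using assms by (simp add: power_divide field_simps card_gt_0_iff)
next
  case False
  have "card R \<le> card B" if "B \<subseteq> F" "R \<subseteq> B" for B
    using that assms by (meson card_mono finite_subset)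
  then have "{B. B \<subseteq> F \<and> card B = b \<and> R \<subseteq> B} = {}" using False by auto
  then show ?thesis by (simp only: card.empty) simp
qed

text \<open>An element of \<open>S\<close> contributes \<open>(1 - q) + q\<close> if it lies in
  \<open>B\<close> and \<open>0 + q\<close> otherwise. Multiplying out leaves only containment
  events, with nonnegative coefficients when \<open>q\<close> lies between 0 and 1.\<close>

lemma power_card_Diff_expansion:
  fixes q :: real
  assumes "finite S"
  shows "q ^ card (S - B) = (\<Sum>R\<in>Pow S. (if R \<subseteq> B then (1 - q) ^ card R * q ^ card (S - R) else 0))"
proof -
  have "q ^ card (S - B) = (\<Prod>e\<in>S. if e \<in> B then 1 else q)"
    using assms by (simp add: prod.If_cases Diff_eq)
  also have "\<dots> = (\<Prod>e\<in>S. (if e \<in> B then 1 - q else 0) + q)"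
    by (rule prod.cong) auto
  also have "\<dots> = (\<Sum>R\<in>Pow S. (\<Prod>e\<in>R. if e \<in> B then 1 - q else 0) * (\<Prod>e\<in>S - R. q))"
    by (rule prod_add[OF assms])
  also have "\<dots> = (\<Sum>R\<in>Pow S. (if R \<subseteq> B then (1 - q) ^ card R * q ^ card (S - R) else 0))"
  proof (rule sum.cong)
    fix R assume "R \<in> Pow S"
    then have fin: "finite R" using assms finite_subset by auto
    show "(\<Prod>e\<in>R. if e \<in> B then 1 - q else 0) * (\<Prod>e\<in>S - R. q)
        = (if R \<subseteq> B then (1 - q) ^ card R * q ^ card (S - R) else 0)"
    proof (cases "R \<subseteq> B")
      case True
      then have "(\<Prod>e\<in>R. if e \<in> B then 1 - q else 0) = (\<Prod>e\<in>R. 1 - q)"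
        by (intro prod.cong) auto
      then show ?thesis using True by simp
    next
      case False
      then have "(\<Prod>e\<in>R. if e \<in> B then 1 - q else 0) = 0"
        using fin by (auto intro!: prod_zero)
      then show ?thesis using False by simp
    qed
  qed simp
  finally show ?thesis .
qed

text \<open>The elements of a random subset of fixed size are negatively correlated, so each
  containment event is at most as likely as under independent choice with density
  \<open>b / card F\<close>. Folding the expansion back gives the value for independent
  choice.\<close>

lemma sum_subsets_power_le:
  fixes q :: real
  assumes "finite F" "b \<le> card F" "S \<subseteq> F" "F \<noteq> {}" "0 \<le> q" "q \<le> 1"
  shows "(\<Sum>B | B \<subseteq> F \<and> card B = b. q ^ card (S - B))
    \<le> (q + (1 - q) * (b / card F)) ^ card S * (card F choose b)"
proof -
  let ?\<B> = "{B. B \<subseteq> F \<and> card B = b}" and ?\<beta> = "real b / card F"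
  have fin: "finite S" using assms finite_subset by auto
  have fin\<B>: "finite ?\<B>" using assms(1) by simp
  have "(\<Sum>B\<in>?\<B>. q ^ card (S - B))
      = (\<Sum>B\<in>?\<B>. \<Sum>R\<in>Pow S. (if R \<subseteq> B then (1 - q) ^ card R * q ^ card (S - R) else 0))"
    by (intro sum.cong power_card_Diff_expansion fin refl)
  also have "\<dots> = (\<Sum>R\<in>Pow S. \<Sum>B\<in>?\<B>. (if R \<subseteq> B then (1 - q) ^ card R * q ^ card (S - R) else 0))"
    by (rule sum.swap)
  also have "\<dots> = (\<Sum>R\<in>Pow S. (1 - q) ^ card R * q ^ card (S - R)
      * real (card {B. B \<subseteq> F \<and> card B = b \<and> R \<subseteq> B}))"
  proof (rule sum.cong)
    fix R
    have "{B \<in> ?\<B>. R \<subseteq> B} = {B. B \<subseteq> F \<and> card B = b \<and> R \<subseteq> B}" by auto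
    then show "(\<Sum>B\<in>?\<B>. (if R \<subseteq> B then (1 - q) ^ card R * q ^ card (S - R) else 0))
        = (1 - q) ^ card R * q ^ card (S - R) * real (card {B. B \<subseteq> F \<and> card B = b \<and> R \<subseteq> B})"
      using fin\<B> by (simp add: sum.inter_filter[symmetric])
  qed simp
  also have "\<dots> \<le> (\<Sum>R\<in>Pow S. (1 - q) ^ card R * q ^ card (S - R)
      * (?\<beta> ^ card R * (card F choose b)))"
    using assms by (intro sum_mono mult_left_mono card_supersets_le) auto
  also have "\<dots> = (\<Sum>R\<in>Pow S. (\<Prod>e\<in>R. (1 - q) * ?\<beta>) * (\<Prod>e\<in>S - R. q)) * (card F choose b)"
    unfolding sum_distrib_right
    by (rule sum.cong) (simp_all add: power_mult_distrib mult_ac del: times_divide_eq_right times_divide_eq_left)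
  also have "(\<Sum>R\<in>Pow S. (\<Prod>e\<in>R. (1 - q) * ?\<beta>) * (\<Prod>e\<in>S - R. q)) = (\<Prod>e\<in>S. (1 - q) * ?\<beta> + q)"
    by (rule prod_add[OF fin, symmetric])
  finally show ?thesis by (simp add: add.commute)
qed

lemma nn_integral_random_breaker_move_le:
  fixes q :: real
  assumes "finite F" "b < card F" "S \<subseteq> F" "0 \<le> q" "q \<le> 1"
  shows "(\<integral>\<^sup>+ B. ennreal (q ^ card (S - B)) \<partial>measure_pmf (random_breaker_move b F))
    \<le> ennreal ((q + (1 - q) * (b / card F)) ^ card S)"
proof -
  let ?\<B> = "{B. B \<subseteq> F \<and> card B = b}"
  have pos: "0 < card F choose b" using assms by simp
  have card\<B>: "card ?\<B> = card F choose b" using n_subsets assms by blast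
  then have \<B>: "finite ?\<B>" "?\<B> \<noteq> {}" using pos assms(1) by (simp, metis card.empty less_irrefl)
  have "min b (card F) = b" using assms by simp
  then have "(\<integral>\<^sup>+ B. ennreal (q ^ card (S - B)) \<partial>measure_pmf (random_breaker_move b F))
      = (\<Sum>B\<in>?\<B>. ennreal (q ^ card (S - B))) / ennreal (card F choose b)"
    unfolding random_breaker_move_def using nn_integral_pmf_of_set[OF \<B>(2,1)] card\<B>
    by (simp add: ennreal_of_nat_eq_real_of_nat)
  also have "\<dots> = ennreal ((\<Sum>B\<in>?\<B>. q ^ card (S - B)) / (card F choose b))"
    using pos assms by (simp add: sum_ennreal divide_ennreal sum_nonneg)
  also have "\<dots> \<le> ennreal ((q + (1 - q) * (b / card F)) ^ card S)"
  proof (rule ennreal_leI)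
    have "F \<noteq> {}" using assms(2) by auto
    then show "(\<Sum>B\<in>?\<B>. q ^ card (S - B)) / (card F choose b) \<le> (q + (1 - q) * (b / card F)) ^ card S"
      using sum_subsets_power_le[of F b S q] assms pos by (simp add: divide_le_eq)
  qed
  finally show ?thesis .
qed

section \<open>The random play\<close>

lemma finite_complete_graph_edges [simp]: "finite (complete_graph_edges n)"
  unfolding complete_graph_edges_def by (rule finite_subset[of _ "Pow {..<n}"]) auto

lemma card_complete_graph_edges: "card (complete_graph_edges n) = n choose 2"
  unfolding complete_graph_edges_def using n_subsets[of "{..<n}" 2] by simp

lemma maker_graph_simps [simp]:
  "maker_graph [] = {}" "maker_graph (h @ [(B, m)]) = maker_graph h \<union> m"
  unfolding maker_graph_def by auto

lemma breaker_graph_simps [simp]: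
  "breaker_graph [] = {}" "breaker_graph (h @ [(B, m)]) = breaker_graph h \<union> B"
  unfolding breaker_graph_def by auto

lemma set_pmf_random_breaker_move:
  assumes "finite F"
  shows "set_pmf (random_breaker_move b F) = {B. B \<subseteq> F \<and> card B = min b (card F)}"
proof -
  obtain B where "B \<subseteq> F" "card B = min b (card F)"
    by (meson min.cobounded2 obtain_subset_with_card_n)
  then show ?thesis unfolding random_breaker_move_def
    using assms by (subst set_pmf_of_set) auto
qed

lemma random_breaker_play_SucE:
  assumes "h' \<in> set_pmf (random_breaker_play n b \<sigma> (Suc k))"
  obtains h B where "h \<in> set_pmf (random_breaker_play n b \<sigma> k)" "B \<subseteq> unclaimed n h"
    "card B = min b (card (unclaimed n h))" "h' = h @ [(B, maker_move n \<sigma> h B)]"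
proof -
  have "finite (unclaimed n h)" for h unfolding unclaimed_def by simp
  then show ?thesis using assms that by (auto simp: set_pmf_random_breaker_move)
qed

text \<open>Until the board runs out, each round removes exactly \<open>b + 1\<close> edges, so the
  number of unclaimed edges is deterministic however Maker plays.\<close>

lemma random_breaker_play_support:
  assumes "legal_strategy n \<sigma>" "h \<in> set_pmf (random_breaker_play n b \<sigma> k)"
    "k * (b + 1) \<le> card (complete_graph_edges n)"
  shows "length h = k \<and> maker_graph h \<inter> breaker_graph h = {} \<and>
    card (unclaimed n h) = card (complete_graph_edges n) - k * (b + 1)"
  using assms(2,3)
proof (induction k arbitrary: h)
  case 0
  then show ?case by (simp add: unclaimed_def)
next
  case (Suc k)
  obtain h0 B where h0: "h0 \<in> set_pmf (random_breaker_play n b \<sigma> k)" "B \<subseteq> unclaimed n h0"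
    "card B = min b (card (unclaimed n h0))" "h = h0 @ [(B, maker_move n \<sigma> h0 B)]"
    using random_breaker_play_SucE[OF Suc.prems(1)] by metis
  let ?U = "unclaimed n h0"
  have IH: "length h0 = k" "maker_graph h0 \<inter> breaker_graph h0 = {}"
    "card ?U = card (complete_graph_edges n) - k * (b + 1)"
    using Suc.IH[OF h0(1)] Suc.prems by auto
  have fin: "finite ?U" unfolding unclaimed_def by simp
  have "b < card ?U" using IH Suc.prems by simp
  then have cB: "card B = b" using h0 by simp
  have finB: "finite B" using h0 fin finite_subset by auto
  then have cU: "card (?U - B) = card ?U - b" using h0 cB by (simp add: card_Diff_subset)
  then have ne: "?U - B \<noteq> {}" using \<open>b < card ?U\<close> by (metis card.empty zero_less_diff less_irrefl)
  then have move: "maker_move n \<sigma> h0 B = {\<sigma> h0 B}" "\<sigma> h0 B \<in> ?U - B"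
    using assms(1) h0 unfolding legal_strategy_def maker_move_def by auto
  have "unclaimed n h = ?U - B - {\<sigma> h0 B}"
    using h0(4) move unfolding unclaimed_def by auto
  then have "card (unclaimed n h) = card ?U - b - 1"
    using move(2) cU fin by simp
  moreover have "maker_graph h \<inter> breaker_graph h = {}"
    using h0 IH(2) move unfolding unclaimed_def by auto
  ultimately show ?case using IH h0(4) by simp
qed

text \<open>The rounds are dependent, also through Maker's replies. A potential whose expectation
  does not increase replaces independence: it starts at the claimed bound and finally dominates the
  indicator of the event.\<close>

lemma prob_breaker_claims_le:
  assumes "legal_strategy n \<sigma>" and S: "S \<subseteq> complete_graph_edges n"
    and T: "T * (b + 1) < card (complete_graph_edges n)"
  shows "measure_pmf.prob (random_breaker_play n b \<sigma> T) {h. S \<subseteq> breaker_graph h}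
    \<le> (real (T * (b + 1)) / card (complete_graph_edges n)) ^ card S"
proof -
  define N where "N = card (complete_graph_edges n)"
  define p where "p k = (real ((T - k) * (b + 1))) / (real N - real (k * (b + 1)))" for k
  \<comment> \<open>\<open>V\<close> is a supermartingale: \<open>p k\<close> is the proportion of the edges unclaimed after \<open>k\<close> rounds that
    will be claimed later, and \<open>p T ^ card (S - breaker_graph h)\<close> is \<open>1\<close> or \<open>0\<close> because \<open>p T = 0\<close>.\<close>
  define V where "V k h = (if S \<inter> maker_graph h = {} then p k ^ card (S - breaker_graph h) else 0)"
    for k h
  have finS: "finite S" by (rule finite_subset[OF S]) simp
  have bound: "real ((k + (T - k)) * (b + 1)) < real N" if "k \<le> T" for k
    using T that N_def by (subst of_nat_less_iff) simp
  have p01: "0 \<le> p k \<and> p k \<le> 1 \<and> real N - real (k * (b + 1)) > 0" if "k \<le> T" for k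
    using bound[OF that] unfolding p_def add_mult_distrib of_nat_add by (auto simp del: of_nat_mult of_nat_add)
  have step: "(\<integral>\<^sup>+ B. ennreal (V (Suc k) (h @ [(B, maker_move n \<sigma> h B)]))
        \<partial>measure_pmf (random_breaker_move b (unclaimed n h))) \<le> ennreal (V k h)"
    if k: "k < T" and h: "h \<in> set_pmf (random_breaker_play n b \<sigma> k)" for k h
  proof (cases "S \<inter> maker_graph h = {}")
    \<comment> \<open>Once Maker owns an edge of \<open>S\<close>, the potential is zero and stays
      zero.\<close>
    case False
    then have "V (Suc k) (h @ [(B, maker_move n \<sigma> h B)]) = 0" for B
      unfolding V_def by auto
    then show ?thesis by simp
  next
    case True
    let ?U = "unclaimed n h" and ?S = "S - breaker_graph h"
    have "k * (b + 1) \<le> T * (b + 1)" using k by (intro mult_le_mono1) simp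
    then have cU: "card ?U = N - k * (b + 1)"
      using random_breaker_play_support[OF assms(1) h] T N_def by linarith
    define f where "f = real (card ?U)"
    have "(k + 1) * (b + 1) \<le> T * (b + 1)" using k by (intro mult_le_mono) auto
    then have lt: "(k + 1) * (b + 1) < N" using T N_def by linarith
    have f: "f = real N - real (k * (b + 1))" unfolding f_def cU using lt by simp
    \<comment> \<open>Of the \<open>f\<close> unclaimed edges, \<open>m\<close> are claimed from
      this round on up to round \<open>T\<close>, and \<open>m'\<close> after this round; hence
      \<open>p k = m / f\<close>.\<close>
    define m where "m = real ((T - k) * (b + 1))"
    define m' where "m' = m - real b - 1"
    have "m' = real ((T - Suc k) * (b + 1))"
    proof -
      have "T - k = Suc (T - Suc k)" using k by simp
      then show ?thesis unfolding m'_def m_def by (simp add: algebra_simps)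
    qed
    then have m': "0 \<le> m'" "p (Suc k) = m' / (f - real b - 1)"
      unfolding p_def f by (simp_all add: algebra_simps)
    have fb: "f - real b - 1 > 0" using p01[of "Suc k"] k unfolding f by (simp add: algebra_simps)
    have mf: "m \<le> f" using bound[of k] k unfolding m_def f add_mult_distrib of_nat_add by linarith
    \<comment> \<open>Maker's edge only helps: \<open>q\<close> is the proportion after Breaker's move alone.\<close>
    define q where "q = (m' + 1) / (f - real b)"
    have q: "0 \<le> q" "q \<le> 1" using m'(1) fb mf unfolding q_def m'_def by auto
    \<comment> \<open>Subtracting one from numerator and denominator does not increase a fraction
      that is at most one.\<close>
    have pq: "p (Suc k) \<le> q"
      using m' fb mf unfolding q_def m'(2) m'_def
      by (simp add: divide_simps) (simp add: algebra_simps)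
    have "V (Suc k) (h @ [(B, maker_move n \<sigma> h B)]) \<le> q ^ card (?S - B)" for B
      unfolding V_def using pq q(1) p01[of "Suc k"] k
      by (auto simp: Diff_eq Int_ac power_mono)
    then have "(\<integral>\<^sup>+ B. ennreal (V (Suc k) (h @ [(B, maker_move n \<sigma> h B)]))
          \<partial>measure_pmf (random_breaker_move b ?U))
        \<le> (\<integral>\<^sup>+ B. ennreal (q ^ card (?S - B)) \<partial>measure_pmf (random_breaker_move b ?U))"
      by (intro nn_integral_mono ennreal_leI)
    also have "\<dots> \<le> ennreal ((q + (1 - q) * (b / f)) ^ card ?S)"
      unfolding f_def
      by (rule nn_integral_random_breaker_move_le)
        (use True S q fb f_def in \<open>auto simp: unclaimed_def\<close>)
    \<comment> \<open>Since \<open>m' + 1 = m - b\<close>, Breaker's \<open>b\<close> edges drop out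
      exactly and the average is \<open>m / f\<close>.\<close>
    also have "q + (1 - q) * (b / f) = p k"
    proof -
      have "q * (f - b) = m - b" using fb unfolding q_def m'_def by simp
      moreover have "q + (1 - q) * (b / f) = (q * (f - b) + b) / f" using fb by (simp add: field_simps)
      ultimately show ?thesis unfolding p_def f[symmetric] m_def[symmetric] by simp
    qed
    finally show ?thesis unfolding V_def using True by simp
  qed
  have EV: "(\<integral>\<^sup>+ h. ennreal (V k h) \<partial>measure_pmf (random_breaker_play n b \<sigma> k)) \<le> ennreal (p 0 ^ card S)"
    if "k \<le> T" for k
    using that
  proof (induction k)
    case 0
    then show ?case by (simp add: V_def)
  next
    case (Suc k)
    have "(\<integral>\<^sup>+ h. ennreal (V (Suc k) h) \<partial>measure_pmf (random_breaker_play n b \<sigma> (Suc k)))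
        = (\<integral>\<^sup>+ h. (\<integral>\<^sup>+ B. ennreal (V (Suc k) (h @ [(B, maker_move n \<sigma> h B)]))
            \<partial>measure_pmf (random_breaker_move b (unclaimed n h))) \<partial>measure_pmf (random_breaker_play n b \<sigma> k))"
      by simp
    also have "\<dots> \<le> (\<integral>\<^sup>+ h. ennreal (V k h) \<partial>measure_pmf (random_breaker_play n b \<sigma> k))"
      by (rule nn_integral_mono_AE) (use Suc.prems step in \<open>auto intro!: AE_pmfI\<close>)
    finally show ?case using Suc by force
  qed
  have "ennreal (measure_pmf.prob (random_breaker_play n b \<sigma> T) {h. S \<subseteq> breaker_graph h})
      = (\<integral>\<^sup>+ h. indicator {h. S \<subseteq> breaker_graph h} h \<partial>measure_pmf (random_breaker_play n b \<sigma> T))"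
    by (simp add: measure_pmf.emeasure_eq_measure)
  also have "\<dots> \<le> (\<integral>\<^sup>+ h. ennreal (V T h) \<partial>measure_pmf (random_breaker_play n b \<sigma> T))"
  proof (rule nn_integral_mono_AE, rule AE_pmfI)
    fix h assume "h \<in> set_pmf (random_breaker_play n b \<sigma> T)"
    \<comment> \<open>If Breaker owns all of \<open>S\<close>, disjointness excludes the zero branch
      of \<open>V\<close>, and the exponent vanishes.\<close>
    then have "maker_graph h \<inter> breaker_graph h = {}"
      using random_breaker_play_support[OF assms(1)] T by simp
    then show "indicator {h. S \<subseteq> breaker_graph h} h \<le> ennreal (V T h)"
      unfolding V_def by (auto simp: indicator_def Diff_eq_empty_iff[THEN iffD2])
  qed
  also have "\<dots> \<le> ennreal (p 0 ^ card S)" using EV by simp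
  finally show ?thesis
    using p01[of 0] unfolding p_def N_def by (simp del: of_nat_mult)
qed

lemma length_random_breaker_play:
  "h \<in> set_pmf (random_breaker_play n b \<sigma> k) \<Longrightarrow> length h = k"
proof (induction k arbitrary: h)
  case (Suc k)
  then show ?case by (auto elim!: random_breaker_play_SucE simp del: random_breaker_play.simps)
qed simp

text \<open>Transfers probabilities computed after \<open>T\<close> rounds to the full game, which
  runs until the board is exhausted.\<close>

lemma random_breaker_play_take:
  "map_pmf (take k) (random_breaker_play n b \<sigma> (k + j)) = random_breaker_play n b \<sigma> k"
proof (induction j)
  case 0
  have "map_pmf (take k) (random_breaker_play n b \<sigma> k) = map_pmf id (random_breaker_play n b \<sigma> k)"
    by (intro map_pmf_cong) (auto dest: length_random_breaker_play)
  then show ?case by (simp add: pmf.map_id)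
next
  case (Suc j)
  have "map_pmf (take k) (random_breaker_play n b \<sigma> (k + Suc j))
      = bind_pmf (random_breaker_play n b \<sigma> (k + j)) (\<lambda>h. return_pmf (take k h))"
    unfolding add_Suc_right random_breaker_play.simps map_bind_pmf
    by (rule bind_pmf_cong) (auto simp: pmf.map_comp o_def dest!: length_random_breaker_play)
  also have "\<dots> = random_breaker_play n b \<sigma> k" using Suc by (simp add: map_pmf_def)
  finally show ?case .
qed

section \<open>Maker's strategy\<close>

text \<open>\<open>G\<close> holds the edges that keep the goal within reach of the remaining
  rounds. The fallback to \<open>U\<close> keeps the strategy legal when Breaker has completed an
  obstacle or the \<open>T\<close> rounds are over.\<close>

definition forcing_strategy ::
    "nat \<Rightarrow> edge set set \<Rightarrow> (edge set \<Rightarrow> bool) \<Rightarrow> nat \<Rightarrow> strategy" where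
  "forcing_strategy n \<F> Q T h B =
     (let U = unclaimed n h - B;
          G = {e \<in> U. can_force (complete_graph_edges n) \<F> Q (T - Suc (length h)) (insert e (maker_graph h))}
      in SOME e. e \<in> (if G = {} then U else G))"

lemma legal_forcing_strategy: "legal_strategy n (forcing_strategy n \<F> Q T)"
proof -
  have choice: "(SOME e. e \<in> (if G = {} then U else G)) \<in> U" if "U \<noteq> {}" "G \<subseteq> U" for G U :: "edge set"
    using that some_in_eq[of "if G = {} then U else G"] by (auto split: if_splits)
  show ?thesis unfolding legal_strategy_def forcing_strategy_def Let_def
    by (intro allI impI, rule choice) auto
qed

text \<open>Breaker's actual graph, current move included, is one of those answered in
  \<open>can_force\<close>. It only grows, so sparing all obstacles at the end implies sparing them
  in every earlier round.\<close>

lemma can_force_forcing_strategy: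
  assumes "can_force (complete_graph_edges n) \<F> Q T {}" and mono: "\<And>M M'. Q M \<Longrightarrow> M \<subseteq> M' \<Longrightarrow> Q M'"
    and "k \<le> T" "h \<in> set_pmf (random_breaker_play n b (forcing_strategy n \<F> Q T) k)"
    and "spares \<F> (breaker_graph h)"
  shows "can_force (complete_graph_edges n) \<F> Q (T - k) (maker_graph h)"
  using assms(3-5)
proof (induction k arbitrary: h)
  case 0
  then show ?case using assms(1) by simp
next
  case (Suc k)
  let ?\<sigma> = "forcing_strategy n \<F> Q T" and ?E = "complete_graph_edges n"
  obtain h0 B where h0: "h0 \<in> set_pmf (random_breaker_play n b ?\<sigma> k)" "B \<subseteq> unclaimed n h0"
    "h = h0 @ [(B, maker_move n ?\<sigma> h0 B)]"
    using random_breaker_play_SucE[OF Suc.prems(2)] by metis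
  have sp: "spares \<F> (breaker_graph h0 \<union> B)" using Suc.prems(3) h0(3) by simp
  then have "spares \<F> (breaker_graph h0)" unfolding spares_def by blast
  then have IH: "can_force ?E \<F> Q (Suc (T - Suc k)) (maker_graph h0)"
    using Suc.IH[OF _ h0(1)] Suc.prems(1) by (simp add: Suc_diff_Suc del: can_force.simps)
  show ?case
  proof (cases "Q (maker_graph h0)")
    case True
    then show ?thesis using mono h0(3) by (intro can_force_goal) auto
  next
    case False
    define G where "G = {e \<in> unclaimed n h0 - B. can_force ?E \<F> Q (T - Suc k) (insert e (maker_graph h0))}"
    obtain e where "e \<in> ?E - maker_graph h0 - (breaker_graph h0 \<union> B)"
      "can_force ?E \<F> Q (T - Suc k) (insert e (maker_graph h0))"
      using IH False sp by auto
    then have "e \<in> G" unfolding G_def unclaimed_def by auto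
    then have "G \<noteq> {}" by auto
    then have "?\<sigma> h0 B \<in> G"
      unfolding forcing_strategy_def Let_def length_random_breaker_play[OF h0(1)] G_def[symmetric]
      by (simp add: some_in_eq)
    moreover have "maker_move n ?\<sigma> h0 B = {?\<sigma> h0 B}"
      using \<open>e \<in> G\<close> unfolding maker_move_def G_def by auto
    ultimately show ?thesis using h0(3) unfolding G_def by auto
  qed
qed

section \<open>Union bound over the obstacles\<close>

lemma card_cross: "A \<inter> B = {} \<Longrightarrow> card (cross A B) = card A * card B"
  unfolding cross_def by (subst card_image) (auto simp: inj_on_def doubleton_eq_iff card_cartesian_product)

lemma obstacles_subset: "S \<in> obstacles n s \<Longrightarrow> S \<subseteq> complete_graph_edges n"
  unfolding obstacles_def cross_def by (auto intro!: doubleton_in_complete_graph)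

lemma obstacles_sum_le:
  fixes q :: real
  assumes "0 \<le> q" "5 * s < n"
  shows "finite (obstacles n s)"
    and "(\<Sum>S\<in>obstacles n s. q ^ card S)
      \<le> real n ^ (2 * s) * q ^ (s ^ 2) + real n ^ (5 * s + 2) * q ^ (n - 1 - 5 * s)"
proof -
  define \<F>1 where "\<F>1 =
     {cross A B |A B. A \<subseteq> {..<n} \<and> B \<subseteq> {..<n} \<and> A \<inter> B = {} \<and> card A = s \<and> card B = s}"
  define \<F>2 where "\<F>2 = {cross {v} W |v W. v < n \<and> W \<subseteq> {..<n} - {v} \<and> card W = n - 1 - 5 * s}"
  define K where "K m = {A. A \<subseteq> {..<n} \<and> card A = m}" for m
  have K: "finite (K m)" "card (K m) = n choose m" for m
    unfolding K_def using n_subsets[of "{..<n}" m] by auto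
  have F1: "\<F>1 \<subseteq> (\<lambda>(A, B). cross A B) ` (K s \<times> K s)"
    unfolding \<F>1_def K_def by auto
  have F2: "\<F>2 \<subseteq> (\<lambda>(v, W). cross {v} W) ` ({..<n} \<times> K (n - 1 - 5 * s))"
    unfolding \<F>2_def K_def by auto
  have fin: "finite \<F>1" "finite \<F>2"
    using finite_subset[OF F1] finite_subset[OF F2] K(1) by auto
  then show "finite (obstacles n s)"
    unfolding obstacles_def \<F>1_def \<F>2_def by simp
  have "card \<F>1 \<le> card (K s \<times> K s)"
    by (rule surj_card_le[OF _ F1]) (simp add: K(1))
  also have "\<dots> \<le> n ^ s * n ^ s"
    unfolding card_cartesian_product K(2) using assms(2) by (intro mult_le_mono binomial_le_pow) auto
  finally have c1: "real (card \<F>1) \<le> real n ^ (2 * s)"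
    by (metis mult_2 of_nat_le_iff of_nat_power power_add)
  have "card \<F>2 \<le> card ({..<n} \<times> K (n - 1 - 5 * s))"
    by (rule surj_card_le[OF _ F2]) (simp add: K(1))
  \<comment> \<open>Counting the small complements instead of the large sets \<open>W\<close> keeps
    the exponent of \<open>n\<close> of order \<open>s\<close>.\<close>
  also have "\<dots> = n * (n choose (5 * s + 1))"
    unfolding card_cartesian_product K(2) using assms(2) binomial_symmetric[of "5 * s + 1" n] by simp
  also have "\<dots> \<le> n * n ^ (5 * s + 1)"
    using assms(2) by (intro mult_le_mono binomial_le_pow) auto
  finally have c2: "real (card \<F>2) \<le> real n ^ (5 * s + 2)"
    by (simp flip: of_nat_power power_Suc)
  \<comment> \<open>The two families may overlap, hence only an inequality.\<close>
  have "(\<Sum>S\<in>obstacles n s. q ^ card S) \<le> (\<Sum>S\<in>\<F>1. q ^ card S) + (\<Sum>S\<in>\<F>2. q ^ card S)"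
    using sum.union_inter[OF fin, of "\<lambda>S. q ^ card S"] sum_nonneg[of "\<F>1 \<inter> \<F>2" "\<lambda>S. q ^ card S"] assms(1)
    unfolding obstacles_def \<F>1_def[symmetric] \<F>2_def[symmetric] by auto
  also have "(\<Sum>S\<in>\<F>1. q ^ card S) = (\<Sum>S\<in>\<F>1. q ^ (s ^ 2))"
    by (rule sum.cong) (auto simp: \<F>1_def card_cross power2_eq_square)
  also have "(\<Sum>S\<in>\<F>2. q ^ card S) = (\<Sum>S\<in>\<F>2. q ^ (n - 1 - 5 * s))"
  proof (rule sum.cong)
    fix S assume "S \<in> \<F>2"
    then obtain v W where "S = cross {v} W" "W \<subseteq> {..<n} - {v}" "card W = n - 1 - 5 * s"
      unfolding \<F>2_def by blast
    then show "q ^ card S = q ^ (n - 1 - 5 * s)" by (subst \<open>S = _\<close>, subst card_cross) auto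
  qed simp
  finally have "(\<Sum>S\<in>obstacles n s. q ^ card S)
      \<le> real (card \<F>1) * q ^ (s ^ 2) + real (card \<F>2) * q ^ (n - 1 - 5 * s)"
    by simp
  also have "\<dots> \<le> real n ^ (2 * s) * q ^ (s ^ 2) + real n ^ (5 * s + 2) * q ^ (n - 1 - 5 * s)"
    using c1 c2 assms(1) by (intro add_mono mult_right_mono) auto
  finally show "(\<Sum>S\<in>obstacles n s. q ^ card S)
      \<le> real n ^ (2 * s) * q ^ (s ^ 2) + real n ^ (5 * s + 2) * q ^ (n - 1 - 5 * s)" .
qed

text \<open>Maker wins whenever Breaker spares all obstacles for \<open>T\<close> rounds; the union
  bound controls the complement, with \<open>r\<close> as an upper bound for the density
  \<open>q\<close> of claimed edges.\<close>

lemma prob_forcing_strategy_wins: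
  fixes r :: real
  assumes s: "5 * s < n" and r: "r < 1"
    and T: "T = n div 2 + 2 * s ^ 2" "real (T * (b + 1)) \<le> r * card (complete_graph_edges n)"
    and \<sigma>: "\<sigma> = forcing_strategy n (obstacles n s) (has_pairing n (n div 2)) T"
    and ne: "complete_graph_edges n \<noteq> {}"
  shows "measure_pmf.prob (random_breaker_game n b \<sigma>) {h. perfect_matching_win n (take T h)}
    \<ge> 1 - (real n ^ (2 * s) * r ^ (s ^ 2) + real n ^ (5 * s + 2) * r ^ (n - 1 - 5 * s))"
proof -
  let ?N = "card (complete_graph_edges n)" and ?\<F> = "obstacles n s"
  let ?play = "random_breaker_play n b \<sigma> T"
  have N: "0 < ?N" using ne by (simp add: card_gt_0_iff)
  then have "r * ?N < ?N" using r by simp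
  then have lt: "T * (b + 1) < ?N" using T(2) of_nat_less_iff[where 'a = real] by (meson le_less_trans)
  have "T \<le> T * (b + 1)" by simp
  then have TN: "T \<le> ?N" using lt by linarith
  define q where "q = real (T * (b + 1)) / ?N"
  have q: "0 \<le> q" "q \<le> r" unfolding q_def using T(2) N by (auto simp: divide_le_eq simp del: of_nat_mult)
  have legal: "legal_strategy n \<sigma>" unfolding \<sigma> by (rule legal_forcing_strategy)
  have fin: "finite ?\<F>" and sum: "(\<Sum>S\<in>?\<F>. r ^ card S)
      \<le> real n ^ (2 * s) * r ^ (s ^ 2) + real n ^ (5 * s + 2) * r ^ (n - 1 - 5 * s)"
    using obstacles_sum_le[OF _ s] q by auto
  have "{h. \<not> spares ?\<F> (breaker_graph h)} = (\<Union>S\<in>?\<F>. {h. S \<subseteq> breaker_graph h})"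
    unfolding spares_def by auto
  then have "measure_pmf.prob ?play {h. \<not> spares ?\<F> (breaker_graph h)}
      \<le> (\<Sum>S\<in>?\<F>. measure_pmf.prob ?play {h. S \<subseteq> breaker_graph h})"
    using measure_UNION_le[OF fin, of "\<lambda>S. {h. S \<subseteq> breaker_graph h}" "measure_pmf ?play"] by simp
  also have "\<dots> \<le> (\<Sum>S\<in>?\<F>. r ^ card S)"
  proof (rule sum_mono)
    fix S assume "S \<in> ?\<F>"
    then have "measure_pmf.prob ?play {h. S \<subseteq> breaker_graph h} \<le> q ^ card S"
      unfolding q_def by (intro prob_breaker_claims_le legal obstacles_subset lt)
    also have "\<dots> \<le> r ^ card S" using q by (intro power_mono)
    finally show "measure_pmf.prob ?play {h. S \<subseteq> breaker_graph h} \<le> r ^ card S" .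
  qed
  also note sum
  finally have bad: "measure_pmf.prob ?play {h. \<not> spares ?\<F> (breaker_graph h)}
      \<le> real n ^ (2 * s) * r ^ (s ^ 2) + real n ^ (5 * s + 2) * r ^ (n - 1 - 5 * s)" .
  have win: "perfect_matching_win n h" if "h \<in> set_pmf ?play" "spares ?\<F> (breaker_graph h)" for h
  proof -
    \<comment> \<open>With no rounds left, \<open>can_force\<close> is the goal itself.\<close>
    have "can_force (complete_graph_edges n) ?\<F> (has_pairing n (n div 2)) (T - T) (maker_graph h)"
      by (rule can_force_forcing_strategy)
        (use that \<sigma> T(1) can_force_perfect_matching[OF s] has_pairing_mono in auto)
    then show ?thesis using has_pairing_matching unfolding perfect_matching_win_def by auto
  qed
  have "1 - measure_pmf.prob ?play {h. \<not> spares ?\<F> (breaker_graph h)}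
      = measure_pmf.prob ?play {h. spares ?\<F> (breaker_graph h)}"
    using measure_pmf.prob_compl[of "{h. \<not> spares ?\<F> (breaker_graph h)}" ?play]
    by (simp add: Compl_eq_Diff_UNIV[symmetric] Collect_neg_eq[symmetric])
  also have "\<dots> \<le> measure_pmf.prob ?play {h. perfect_matching_win n h}"
    by (rule measure_pmf.finite_measure_mono_AE) (use win in \<open>auto intro!: AE_pmfI\<close>)
  also have "\<dots> = measure_pmf.prob (map_pmf (take T) (random_breaker_play n b \<sigma> (T + (?N - T))))
      {h. perfect_matching_win n h}"
    by (simp only: random_breaker_play_take)
  also have "\<dots> = measure_pmf.prob (random_breaker_game n b \<sigma>) {h. perfect_matching_win n (take T h)}"
    unfolding random_breaker_game_def using TN by (simp add: vimage_def)
  finally show ?thesis using bad by linarith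
qed

section \<open>Asymptotics\<close>

lemma fourth_root_floor:
  assumes "1 \<le> n"
  defines "s \<equiv> nat \<lfloor>real n powr (1/4)\<rfloor>"
  shows "real s \<le> real n powr (1/4)" "real n powr (1/4) - 1 \<le> real s" "0 \<le> real n powr (1/4) - 1"
    "real s ^ 2 \<le> sqrt (real n)"
proof -
  show 1: "real s \<le> real n powr (1/4)" unfolding s_def by simp
  show "real n powr (1/4) - 1 \<le> real s" unfolding s_def by linarith
  show "0 \<le> real n powr (1/4) - 1" using assms(1) by (simp add: ge_one_powr_ge_zero)
  have "real s ^ 2 \<le> (real n powr (1/4)) ^ 2" using 1 by (intro power_mono) auto
  also have "\<dots> = real n powr (1/4 + 1/4)" by (simp only: power2_eq_square powr_add)
  also have "\<dots> = sqrt (real n)" by (simp add: powr_half_sqrt)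
  finally show "real s ^ 2 \<le> sqrt (real n)" .
qed

text \<open>In the exponents, \<open>s ^ 2\<close> outweighs \<open>s * ln n\<close> because
  \<open>s\<close> grows faster than \<open>ln n\<close>, and \<open>n\<close> outweighs
  \<open>s * ln n\<close> because \<open>s\<close> is only of order
  \<open>n powr (1/4)\<close>.\<close>

lemma error_term_tendsto_0:
  fixes r :: real
  assumes "0 < r" "r < 1"
  defines "s \<equiv> \<lambda>n::nat. nat \<lfloor>real n powr (1/4)\<rfloor>"
  shows "(\<lambda>n. real n ^ (2 * s n) * r ^ (s n ^ 2) + real n ^ (5 * s n + 2) * r ^ (n - 1 - 5 * s n)) \<longlonglongrightarrow> 0"
proof -
  define c where "c = - ln r"
  have c: "c > 0" using assms unfolding c_def by simp
  define x where "x n = real n powr (1/4)" for n :: nat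
  \<comment> \<open>A majorant free of floors: \<open>s n\<close> is bounded by \<open>x n\<close>
    from above and by \<open>x n - 1\<close> from below, whichever increases the term.\<close>
  define U where "U n = exp (2 * x n * ln n - c * (x n - 1) ^ 2)
    + exp ((5 * x n + 2) * ln n - c * (real n - 1 - 5 * x n))" for n :: nat
  have lim: "U \<longlonglongrightarrow> 0"
    unfolding U_def x_def using c by real_asymp
  \<comment> \<open>This makes the natural subtraction \<open>n - 1 - 5 * s n\<close> exact.\<close>
  have large: "eventually (\<lambda>n. 5 * x n + 1 \<le> real n) sequentially"
    unfolding x_def by real_asymp
  have "eventually (\<lambda>n. real n ^ (2 * s n) * r ^ (s n ^ 2) + real n ^ (5 * s n + 2) * r ^ (n - 1 - 5 * s n) \<le> U n) sequentially"
    using large eventually_ge_at_top[of 1]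
  proof eventually_elim
    case (elim n)
    have "s n = nat \<lfloor>real n powr (1/4)\<rfloor>" by (simp add: s_def)
    note root = fourth_root_floor[OF elim(2), folded this, folded x_def]
    have ln: "0 \<le> ln (real n)" using elim by simp
    have pow: "real n ^ i * r ^ j = exp (real i * ln n - c * real j)" for i j
      using elim assms(1) unfolding c_def
      by (simp add: exp_add exp_diff exp_minus exp_of_nat_mult field_simps)
    have "real n ^ (2 * s n) * r ^ (s n ^ 2) \<le> exp (2 * x n * ln n - c * (x n - 1) ^ 2)"
      unfolding pow exp_le_cancel_iff
    proof (rule diff_mono)
      show "real (2 * s n) * ln n \<le> 2 * x n * ln n" using root ln by (intro mult_right_mono) auto
      show "c * (x n - 1) ^ 2 \<le> c * real (s n ^ 2)"
        using root c unfolding of_nat_power by (intro mult_left_mono power_mono) auto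
    qed
    moreover have "real n ^ (5 * s n + 2) * r ^ (n - 1 - 5 * s n)
        \<le> exp ((5 * x n + 2) * ln n - c * (real n - 1 - 5 * x n))"
      unfolding pow exp_le_cancel_iff
    proof (rule diff_mono)
      show "real (5 * s n + 2) * ln n \<le> (5 * x n + 2) * ln n"
        using root ln by (intro mult_right_mono) auto
      have "5 * s n + 1 \<le> n" using root(1) elim(1) by linarith
      then have "real (n - 1 - 5 * s n) = real n - 1 - 5 * real (s n)" by (simp add: of_nat_diff)
      then show "c * (real n - 1 - 5 * x n) \<le> c * real (n - 1 - 5 * s n)"
        using root c by (intro mult_left_mono) auto
    qed
    ultimately show ?case unfolding U_def by linarith
  qed
  then show ?thesis
    by (rule tendsto_sandwich[OF _ _ tendsto_const lim, rotated]) (use assms in auto)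
qed

text \<open>About \<open>n / 2\<close> rounds with at most \<open>(1 - \<epsilon>) * n\<close>
  Breaker edges each use a fraction \<open>1 - \<epsilon>\<close> of about \<open>n ^ 2 / 2\<close>
  edges; the spare \<open>\<epsilon> / 2\<close> absorbs Maker's edges and the extra
  \<open>2 * s ^ 2\<close> rounds.\<close>

lemma rounds_times_bias_le:
  fixes \<epsilon> :: real and b :: "nat \<Rightarrow> nat"
  assumes "0 < \<epsilon>" "\<epsilon> \<le> 1" and b: "\<And>n. real (b n) \<le> (1 - \<epsilon>) * real n"
  defines "s \<equiv> \<lambda>n::nat. nat \<lfloor>real n powr (1/4)\<rfloor>"
  shows "eventually (\<lambda>n. real ((n div 2 + 2 * s n ^ 2) * (b n + 1))
    \<le> (1 - \<epsilon> / 2) * card (complete_graph_edges n)) sequentially"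
proof -
  define t where "t n = real n / 2 + 2 * sqrt (real n)" for n :: nat
  define N where "N n = real n * (real n - 1) / 2" for n :: nat
  have "(\<lambda>n. (1 - \<epsilon>) * (real n * t n / N n) + t n / N n) \<longlonglongrightarrow> (1 - \<epsilon>) * 1 + 0"
  proof (intro tendsto_intros)
    show "(\<lambda>n. real n * t n / N n) \<longlonglongrightarrow> 1" unfolding t_def N_def by real_asymp
    show "(\<lambda>n. t n / N n) \<longlonglongrightarrow> 0" unfolding t_def N_def by real_asymp
  qed
  then have "eventually (\<lambda>n. (1 - \<epsilon>) * (real n * t n / N n) + t n / N n < 1 - \<epsilon> / 2) sequentially"
    by (rule order_tendstoD) (use assms in auto)
  then show ?thesis using eventually_ge_at_top[of 2]
  proof eventually_elim
    case (elim n)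
    have root: "real (s n) ^ 2 \<le> sqrt (real n)"
      using fourth_root_floor(4)[of n] elim unfolding s_def by simp
    have N: "N n > 0" unfolding N_def using elim by simp
    have card: "real (card (complete_graph_edges n)) = N n"
    proof -
      have "even (n * (n - 1))" by (cases n) auto
      then show ?thesis unfolding card_complete_graph_edges N_def choose_two
        using elim by (simp add: real_of_nat_div of_nat_diff)
    qed
    have "real (n div 2 + 2 * s n ^ 2) \<le> t n"
    proof -
      have "real (n div 2) \<le> real n / 2" by linarith
      then show ?thesis unfolding t_def using root by simp
    qed
    then have "real ((n div 2 + 2 * s n ^ 2) * (b n + 1)) \<le> t n * ((1 - \<epsilon>) * real n + 1)"
      unfolding of_nat_mult using b[of n] by (intro mult_mono) (auto simp: t_def)
    also have "\<dots> = ((1 - \<epsilon>) * (real n * t n / N n) + t n / N n) * N n"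
      using N by (simp add: field_simps)
    also have "\<dots> \<le> (1 - \<epsilon> / 2) * N n"
      using elim N by (intro mult_right_mono) auto
    finally show ?case unfolding card .
  qed
qed

theorem theorem1p2:
  fixes \<epsilon> :: real and b :: "nat \<Rightarrow> nat"
  assumes "\<epsilon> > 0"
    and "\<And>n. real (b n) \<le> (1 - \<epsilon>) * real n"
  shows "\<exists>\<sigma> :: nat \<Rightarrow> strategy.
     (\<forall>n. legal_strategy n (\<sigma> n)) \<and>
     (\<lambda>n. measure_pmf.prob (random_breaker_game n (b n) (\<sigma> n))
            {h. perfect_matching_win n h}) \<longlonglongrightarrow> 1 \<and>
     (\<exists>\<delta> :: nat \<Rightarrow> real. \<delta> \<longlonglongrightarrow> 0 \<and>
       (\<lambda>n. measure_pmf.prob (random_breaker_game n (b n) (\<sigma> n))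
              {h. perfect_matching_win_within n ((1 + \<delta> n) * (real n / 2)) h}) \<longlonglongrightarrow> 1)"
proof -
  \<comment> \<open>At \<open>n = 1\<close> the bias bound reads
    \<open>0 \<le> b 1 \<le> 1 - \<epsilon>\<close>.\<close>
  have \<epsilon>: "\<epsilon> \<le> 1" using assms(2)[of 1] of_nat_0_le_iff[of "b 1", where 'a = real] by (simp del: of_nat_0_le_iff)
  define s where "s n = nat \<lfloor>real n powr (1/4)\<rfloor>" for n :: nat
  define T where "T n = n div 2 + 2 * s n ^ 2" for n
  define \<sigma> where "\<sigma> n = forcing_strategy n (obstacles n (s n)) (has_pairing n (n div 2)) (T n)" for n
  \<comment> \<open>Chosen so that \<open>(1 + \<delta> n) * (real n / 2)\<close> equals
    \<open>T n\<close> for positive \<open>n\<close>.\<close>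
  define \<delta> where "\<delta> n = 2 * real (T n) / real n - 1" for n
  define r where "r = 1 - \<epsilon> / 2"
  have r: "0 < r" "r < 1" using \<epsilon> assms(1) unfolding r_def by auto
  define err where "err n = real n ^ (2 * s n) * r ^ (s n ^ 2) + real n ^ (5 * s n + 2) * r ^ (n - 1 - 5 * s n)"
    for n
  have err: "(\<lambda>n. 1 - err n) \<longlonglongrightarrow> 1"
    using tendsto_diff[OF tendsto_const[of 1] error_term_tendsto_0[OF r, folded s_def]]
    unfolding err_def by simp
  have fast: "eventually (\<lambda>n. 1 - err n \<le> measure_pmf.prob (random_breaker_game n (b n) (\<sigma> n))
      {h. perfect_matching_win n (take (T n) h)}) sequentially"
  proof -
    have "eventually (\<lambda>n. 5 * real n powr (1/4) < real n) sequentially" by real_asymp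
    then show ?thesis
      using rounds_times_bias_le[OF assms(1) \<epsilon> assms(2), folded s_def] eventually_ge_at_top[of 2]
    proof eventually_elim
      case (elim n)
      have "5 * s n < n"
        using elim fourth_root_floor(1)[of n] unfolding s_def by linarith
      moreover have "complete_graph_edges n \<noteq> {}"
        using doubleton_in_complete_graph[of 0 n 1] elim by auto
      ultimately show ?case unfolding err_def
        by (intro prob_forcing_strategy_wins)
          (use elim r in \<open>auto simp: T_def \<sigma>_def r_def\<close>)
    qed
  qed
  \<comment> \<open>Both limits in the claim concern events implied by a win within
    \<open>T n\<close> rounds, so one squeeze argument serves both.\<close>
  have limit: "(\<lambda>n. measure_pmf.prob (random_breaker_game n (b n) (\<sigma> n)) {h. W n h}) \<longlonglongrightarrow> 1"
    if W: "\<And>n h. n \<ge> 1 \<Longrightarrow> perfect_matching_win n (take (T n) h) \<Longrightarrow> W n h" for W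
  proof (rule tendsto_sandwich[OF _ _ err tendsto_const])
    show "eventually (\<lambda>n. 1 - err n \<le> measure_pmf.prob (random_breaker_game n (b n) (\<sigma> n)) {h. W n h}) sequentially"
      using fast eventually_ge_at_top[of 1]
    proof eventually_elim
      case (elim n)
      note elim(1)
      also have "measure_pmf.prob (random_breaker_game n (b n) (\<sigma> n)) {h. perfect_matching_win n (take (T n) h)}
          \<le> measure_pmf.prob (random_breaker_game n (b n) (\<sigma> n)) {h. W n h}"
        using W elim(2) by (intro measure_pmf.finite_measure_mono) auto
      finally show ?case .
    qed
  qed simp
  have "\<delta> \<longlonglongrightarrow> 0"
  proof (rule tendsto_sandwich)
    show "eventually (\<lambda>n. - 2 / real n \<le> \<delta> n) sequentially"
      using eventually_ge_at_top[of 1]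
    proof eventually_elim
      case (elim n)
      have "real n - 2 \<le> 2 * real (n div 2) + 4 * real (s n) ^ 2" using zero_le_power2[of "real (s n)"] by linarith
      then show ?case unfolding \<delta>_def T_def using elim by (simp add: field_simps)
    qed
    show "eventually (\<lambda>n. \<delta> n \<le> 4 * sqrt (real n) / real n) sequentially"
      using eventually_ge_at_top[of 1]
    proof eventually_elim
      case (elim n)
      have "2 * real (n div 2) \<le> real n" by linarith
      then have "2 * real (T n) - real n \<le> 4 * sqrt (real n)"
        unfolding T_def using fourth_root_floor(4)[OF elim, folded s_def] by simp
      then have "(2 * real (T n) - real n) / real n \<le> 4 * sqrt (real n) / real n"
        by (rule divide_right_mono) simp
      then show ?case unfolding \<delta>_def using elim by (simp add: diff_divide_distrib)
    qed
  qed real_asymp+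
  moreover have "(\<lambda>n. measure_pmf.prob (random_breaker_game n (b n) (\<sigma> n))
      {h. perfect_matching_win_within n ((1 + \<delta> n) * (real n / 2)) h}) \<longlonglongrightarrow> 1"
    by (rule limit) (auto simp: perfect_matching_win_within_def \<delta>_def intro!: exI[of _ "T _"])
  moreover have "(\<lambda>n. measure_pmf.prob (random_breaker_game n (b n) (\<sigma> n))
      {h. perfect_matching_win n h}) \<longlonglongrightarrow> 1"
  proof (rule limit)
    fix n h assume "perfect_matching_win n (take (T n) h)"
    moreover have "maker_graph (take (T n) h) \<subseteq> maker_graph h"
      unfolding maker_graph_def by (intro UN_mono set_take_subset) auto
    ultimately show "perfect_matching_win n h" unfolding perfect_matching_win_def by blast
  qed
  moreover have "\<forall>n. legal_strategy n (\<sigma> n)"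
    unfolding \<sigma>_def by (simp add: legal_forcing_strategy)
  ultimately show ?thesis by blast
qed

end
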